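(* Let $(\Psi_l,\Psi_u,\epsilon)$ be a solution of the optimization problem (P) described in the context, let $V_u=-\lambda\log\Psi_l$, and let $V^*$ be the value function of the stochastic optimal control problem described in the context. Then $V_u$ is an upper bound of the optimal cost $V^*$ such that, pointwise on $\Omega$, $$0\le V_u-V^*\le -\lambda\log\left(1-\min\left\{1,\frac{\epsilon}{\eta}\right\}\right),\qquad \eta=e^{-\|V^*\|_\infty/\lambda}.$$
   Context: Setting. $\mathbb{R}[x]$ denotes real polynomials in $x\in\mathbb{R}^n$, and $\mathbb{R}_+=[0,\infty)$. $\Omega\subset\mathbb{R}^n$ is a compact basic closed semialgebraic set, $\Omega=\{x: g_i(x)\ge 0,\ i=1,\dots,k\}$ with $g_i\in\mathbb{R}[x]$, $0\in\Omega$; its boundary is $\partial\Omega=\{x:\prod_{i=1}^m h_i(x)=0\}$ with $h_i\in\mathbb{R}[x]$; the origin is treated as part of the boundary. The system is $dx_t=(f(x_t)+G(x_t)u_t)\,dt+B(x_t)\,d\omega_t$, where $x_t\in\Omega$, $u_t$ is the (vector) control, $f,G,B$ are vector/matrix valued with entries in $\mathbb{R}[x]$, $f(0)=0$, $G(0)=0$, $B(0)=0$, and $\omega_t$ is a vector Brownian motion with covariance $\Sigma_\epsilon$ (increments $\omega_t-\omega_s\sim\mathcal N(0,\Sigma_\epsilon(t-s))$). The cost is $\mathbb{E}_{\omega_t}[J(x,u)]=\mathbb{E}_{\omega_t}\left[\phi(x_T)+\int_0^T q(x_t)+\tfrac12u_t^TRu_t\,dt\right]$, where $T$ is the first time the state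 reaches $\partial\Omega$ or the origin, $R$ is a positive definite matrix, and $q,\phi\in\mathbb{R}[x]$ map $\Omega\to\mathbb{R}_+$ and are positive definite (zero at $0$, positive on $\Omega\setminus\{0\}$). The expectation is over realizations of the noise. The value function is the minimal expected cost as a function of the initial state. HJB equation: $0=q+(\nabla_xV)^Tf-\tfrac12(\nabla_xV)^TGR^{-1}G^T(\nabla_xV)+\tfrac12\mathrm{Tr}\left((\nabla_{xx}V)B\Sigma_\epsilon B^T\right)$ on $\Omega$ with $V=\phi$ on $\partial\Omega$. It is assumed there is $\lambda>0$ with $\lambda G(x)R^{-1}G(x)^T=B(x)\Sigma_\epsilon B(x)^T=:\Sigma(x)$. With $V=-\lambda\log\Psi$, the HJB equation becomes the linear PDE $0=-\tfrac1\lambda q\Psi+\mathcal L(\Psi)$ on $\Omega$, $\Psi=\psi:=e^{-\phi/\lambda}$ on $\partial\Omega$, where $\mathcal L(\Psi)=f^T(\nabla_x\Psi)+\tfrac12\mathrm{Tr}((\nabla_{xx}\Psi)\Sigma)$. It is assumed that unique viscosity solutions $V^*$ and $\Psi^*$ of these two problems exist; $V^*=-\lambda\log\Psi^*$ is the value function. Norm: $\|F\|_\infty=\sup_{x\in\Omega}|F(x)|$. Problem (P): minimize $\epsilon$ over polynomials $\Psi_l,\Psi_u\in\mathbb{R}[x]$ subject to $\tfrac1\lambda q\Psi_l-\mathcal L(\Psi_l)\le 0$ on $\Omega$; $0\le\tfrac1\lambda q\Psi_u-\mathcal L(\Psi_u)$ on $\Omega$; $\Psi_u-\Psi_l\le\epsilon$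 on $\Omega$; $0\le\Psi_l\le\psi\le\Psi_u$ on $\partial\Omega$; for each coordinate $i$, $\partial_{x^i}\Psi_l\le0$ at points of $\Omega$ with $x^i\ge0$ and $\partial_{x^i}\Psi_l\ge 0$ at points of $\Omega$ with $x^i\le 0$; and $\Psi_l(0)=1$. It is understood that $\Psi_l>0$ on $\Omega$, so that $V_u=-\lambda\log\Psi_l$ is well defined. The upper bound is read as $+\infty$ when $\epsilon\ge\eta$. *)

theory Defs
  imports "HOL-Analysis.Analysis" "HOL-Probability.Probability"
begin

section \<open>Matrices and differential operators\<close>

definition pos_def_matrix :: "real^'m^'m \<Rightarrow> bool" where
  "pos_def_matrix A \<longleftrightarrow> transpose A = A \<and> (\<forall>v. v \<noteq> 0 \<longrightarrow> 0 < v \<bullet> (A *v v))"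

definition pos_semidef_matrix :: "real^'m^'m \<Rightarrow> bool" where
  "pos_semidef_matrix A \<longleftrightarrow> transpose A = A \<and> (\<forall>v. 0 \<le> v \<bullet> (A *v v))"

definition grad :: "(real^'n \<Rightarrow> real) \<Rightarrow> real^'n \<Rightarrow> real^'n" where
  "grad F x = (\<chi> i. frechet_derivative F (at x) (axis i 1))"

definition hess :: "(real^'n \<Rightarrow> real) \<Rightarrow> real^'n \<Rightarrow> real^'n^'n" where
  "hess F x = jacobian (grad F) (at x)"

text \<open>Only used for open \<open>S\<close>, where it says that \<open>F\<close> is twice continuously differentiable.\<close>

definition C2_on :: "(real^'n) set \<Rightarrow> (real^'n \<Rightarrow> real) \<Rightarrow> bool" where
  "C2_on S F \<longleftrightarrow> (\<forall>x\<in>S. F differentiable (at x) \<and> grad F differentiable (at x)) \<and>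
     continuous_on S (hess F)"

definition sup_norm_on :: "'a set \<Rightarrow> ('a \<Rightarrow> real) \<Rightarrow> real" where
  "sup_norm_on S F = (SUP x\<in>S. \<bar>F x\<bar>)"


section \<open>Viscosity solutions of Dirichlet problems\<close>

text \<open>
  For an operator \<open>H x r p X\<close>, nonincreasing in the matrix argument \<open>X\<close>, these are the solutions of
  \<open>H x (u x) (grad u x) (hess u x) = 0\<close> on \<open>S - D\<close> with \<open>u = b\<close> on \<open>D\<close>, where \<open>S - D\<close> is open.
  The boundary values are attained pointwise.
\<close>

definition viscosity_subsolution_on ::
  "(real^'n) set \<Rightarrow> (real^'n \<Rightarrow> real \<Rightarrow> real^'n \<Rightarrow> real^'n^'n \<Rightarrow> real) \<Rightarrow> (real^'n \<Rightarrow> real) \<Rightarrow> bool" where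
  "viscosity_subsolution_on U H u \<longleftrightarrow>
     (\<forall>\<xi> x0. C2_on U \<xi> \<and> x0 \<in> U \<and>
        (\<forall>\<^sub>F y in at x0 within U. u y - \<xi> y \<le> u x0 - \<xi> x0) \<longrightarrow>
        H x0 (u x0) (grad \<xi> x0) (hess \<xi> x0) \<le> 0)"

definition viscosity_supersolution_on ::
  "(real^'n) set \<Rightarrow> (real^'n \<Rightarrow> real \<Rightarrow> real^'n \<Rightarrow> real^'n^'n \<Rightarrow> real) \<Rightarrow> (real^'n \<Rightarrow> real) \<Rightarrow> bool" where
  "viscosity_supersolution_on U H u \<longleftrightarrow>
     (\<forall>\<xi> x0. C2_on U \<xi> \<and> x0 \<in> U \<and>
        (\<forall>\<^sub>F y in at x0 within U. u x0 - \<xi> x0 \<le> u y - \<xi> y) \<longrightarrow>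
        0 \<le> H x0 (u x0) (grad \<xi> x0) (hess \<xi> x0))"

definition viscosity_solution ::
  "(real^'n) set \<Rightarrow> (real^'n) set \<Rightarrow> (real^'n \<Rightarrow> real \<Rightarrow> real^'n \<Rightarrow> real^'n^'n \<Rightarrow> real) \<Rightarrow>
   (real^'n \<Rightarrow> real) \<Rightarrow> (real^'n \<Rightarrow> real) \<Rightarrow> bool" where
  "viscosity_solution S D H b u \<longleftrightarrow> continuous_on S u \<and>
     viscosity_subsolution_on (S - D) H u \<and> viscosity_supersolution_on (S - D) H u \<and>
     (\<forall>x\<in>D. u x = b x)"

definition unique_viscosity_solution ::
  "(real^'n) set \<Rightarrow> (real^'n) set \<Rightarrow> (real^'n \<Rightarrow> real \<Rightarrow> real^'n \<Rightarrow> real^'n^'n \<Rightarrow> real) \<Rightarrow>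
   (real^'n \<Rightarrow> real) \<Rightarrow> (real^'n \<Rightarrow> real) \<Rightarrow> bool" where
  "unique_viscosity_solution S D H b u \<longleftrightarrow> viscosity_solution S D H b u \<and>
     (\<forall>v. viscosity_solution S D H b v \<longrightarrow> (\<forall>x\<in>S. v x = u x))"


section \<open>The Hamilton-Jacobi-Bellman equation and its linearization\<close>

definition noise_cov ::
  "(real^'n \<Rightarrow> real^'p^'n) \<Rightarrow> real^'p^'p \<Rightarrow> real^'n \<Rightarrow> real^'n^'n" where
  "noise_cov B \<Sigma>\<epsilon> x = B x ** \<Sigma>\<epsilon> ** transpose (B x)"

definition generator ::
  "(real^'n \<Rightarrow> real^'n) \<Rightarrow> (real^'n \<Rightarrow> real^'n^'n) \<Rightarrow> real^'n \<Rightarrow> real^'n \<Rightarrow> real^'n^'n \<Rightarrow> real" where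
  "generator f A x p X = f x \<bullet> p + trace (X ** A x) / 2"

definition lin_op ::
  "(real^'n \<Rightarrow> real^'n) \<Rightarrow> (real^'n \<Rightarrow> real^'n^'n) \<Rightarrow> (real^'n \<Rightarrow> real) \<Rightarrow> real^'n \<Rightarrow> real" where
  "lin_op f A F x = generator f A x (grad F x) (hess F x)"

text \<open>
  Both operators are the negatives of the usual right-hand sides, so that they are nonincreasing
  in \<open>X\<close>, as the sign convention for viscosity sub- and supersolutions requires.
\<close>

definition hjb_operator ::
  "(real^'n \<Rightarrow> real^'n) \<Rightarrow> (real^'n \<Rightarrow> real^'m^'n) \<Rightarrow> (real^'n \<Rightarrow> real^'n^'n) \<Rightarrow>
   (real^'n \<Rightarrow> real) \<Rightarrow> real^'m^'m \<Rightarrow> real^'n \<Rightarrow> real \<Rightarrow> real^'n \<Rightarrow> real^'n^'n \<Rightarrow> real" where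
  "hjb_operator f G A q R x r p X =
     - (q x + p \<bullet> f x - (p \<bullet> ((G x ** matrix_inv R ** transpose (G x)) *v p)) / 2
        + trace (X ** A x) / 2)"

definition linear_operator ::
  "(real^'n \<Rightarrow> real^'n) \<Rightarrow> (real^'n \<Rightarrow> real^'n^'n) \<Rightarrow> (real^'n \<Rightarrow> real) \<Rightarrow> real \<Rightarrow>
   real^'n \<Rightarrow> real \<Rightarrow> real^'n \<Rightarrow> real^'n^'n \<Rightarrow> real" where
  "linear_operator f A q lam x r p X = - (- (1 / lam) * q x * r + generator f A x p X)"


section \<open>The stochastic optimal control problem\<close>

text \<open>
  Gaussian increments are specified by their characteristic function, which also covers a
  degenerate covariance. Only nonnegative times matter.
\<close>

definition brownian_motion ::
  "'w measure \<Rightarrow> (real \<Rightarrow> 'w measure) \<Rightarrow> real^'p^'p \<Rightarrow> (real \<Rightarrow> 'w \<Rightarrow> real^'p) \<Rightarrow> bool" where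
  "brownian_motion M \<F> \<Sigma>\<epsilon> W \<longleftrightarrow>
     pos_semidef_matrix \<Sigma>\<epsilon> \<and>
     prob_space M \<and> filtration (space M) \<F> \<and> (\<forall>t. sets (\<F> t) \<subseteq> sets M) \<and>
     (\<forall>t\<ge>0. W t \<in> borel_measurable (\<F> t)) \<and>
     (\<forall>w\<in>space M. continuous_on {0..} (\<lambda>t. W t w)) \<and>
     (AE w in M. W 0 w = 0) \<and>
     (\<forall>s t. 0 \<le> s \<and> s \<le> t \<longrightarrow>
        prob_space.indep_set M (sets (\<F> s))
          {(\<lambda>w. W t w - W s w) -` A \<inter> space M | A. A \<in> sets borel} \<and>
        (\<forall>a. (LINT w|M. iexp (a \<bullet> (W t w - W s w))) =
             complex_of_real (exp (- (t - s) * (a \<bullet> (\<Sigma>\<epsilon> *v a)) / 2))))"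

definition progressive ::
  "(real \<Rightarrow> 'w measure) \<Rightarrow> (real \<Rightarrow> 'w \<Rightarrow> 'a::topological_space) \<Rightarrow> bool" where
  "progressive \<F> u \<longleftrightarrow>
     (\<forall>t\<ge>0. (\<lambda>(s, w). u s w) \<in> borel_measurable (restrict_space borel {0..t} \<Otimes>\<^sub>M \<F> t))"

text \<open>First time at which \<open>X\<close> meets \<open>D\<close>; it is \<open>\<infinity>\<close> on paths that never do.\<close>

definition hit_time :: "'a set \<Rightarrow> (real \<Rightarrow> 'w \<Rightarrow> 'a) \<Rightarrow> 'w \<Rightarrow> ereal" where
  "hit_time D X w = Inf (ereal ` {t. 0 \<le> t \<and> X t w \<in> D})"

definition stopped :: "('w \<Rightarrow> ereal) \<Rightarrow> real \<Rightarrow> 'w \<Rightarrow> real" where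
  "stopped \<tau> t w = real_of_ereal (min (ereal t) (\<tau> w))"

text \<open>
  \<open>I\<close> is the Ito integral of \<open>Y\<close> against \<open>W\<close> over \<open>[0, min t \<tau>]\<close>. For an integrand that is adapted
  with continuous paths, the only kind used below, the Ito integral is the limit in probability of
  the left-endpoint Riemann sums.
\<close>

definition is_ito_integral ::
  "'w measure \<Rightarrow> (real \<Rightarrow> 'w \<Rightarrow> real^'p) \<Rightarrow> (real \<Rightarrow> 'w \<Rightarrow> real^'p^'n) \<Rightarrow> ('w \<Rightarrow> ereal) \<Rightarrow>
   real \<Rightarrow> ('w \<Rightarrow> real^'n) \<Rightarrow> bool" where
  "is_ito_integral M W Y \<tau> t I \<longleftrightarrow>
     (\<forall>e>0. (\<lambda>N. measure M {w \<in> space M.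
          e < norm ((\<Sum>k<N. Y (real k * t / real N) w *v
                       (W (stopped \<tau> (real (Suc k) * t / real N) w) w
                        - W (stopped \<tau> (real k * t / real N) w) w)) - I w)}) \<longlonglongrightarrow> 0)"

text \<open>
  \<open>X\<close> solves \<open>dX = (f(X) + G(X) u) dt + B(X) dW\<close> with \<open>X 0 = x0\<close> up to the first time it meets \<open>D\<close>;
  what \<open>X\<close> does after that time is irrelevant.
\<close>

definition controlled_trajectory ::
  "'w measure \<Rightarrow> (real \<Rightarrow> 'w measure) \<Rightarrow> (real \<Rightarrow> 'w \<Rightarrow> real^'p) \<Rightarrow>
   (real^'n \<Rightarrow> real^'n) \<Rightarrow> (real^'n \<Rightarrow> real^'m^'n) \<Rightarrow> (real^'n \<Rightarrow> real^'p^'n) \<Rightarrow>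
   (real^'n) set \<Rightarrow> (real^'n) set \<Rightarrow> real^'n \<Rightarrow>
   (real \<Rightarrow> 'w \<Rightarrow> real^'m) \<Rightarrow> (real \<Rightarrow> 'w \<Rightarrow> real^'n) \<Rightarrow> bool" where
  "controlled_trajectory M \<F> W f G B \<Omega> D x0 u X \<longleftrightarrow>
     progressive \<F> u \<and>
     (\<forall>t\<ge>0. X t \<in> borel_measurable (\<F> t)) \<and>
     (\<forall>w\<in>space M. continuous_on {0..} (\<lambda>t. X t w) \<and> X 0 w = x0 \<and>
        (\<forall>t\<ge>0. ereal t \<le> hit_time D X w \<longrightarrow> X t w \<in> \<Omega>)) \<and>
     (\<forall>t\<ge>0.
        (AE w in M. set_integrable lborel {0..stopped (hit_time D X) t w}
                      (\<lambda>s. f (X s w) + G (X s w) *v u s w)) \<and>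
        is_ito_integral M W (\<lambda>s w. B (X s w)) (hit_time D X) t
          (\<lambda>w. X (stopped (hit_time D X) t w) w - x0
             - set_lebesgue_integral lborel {0..stopped (hit_time D X) t w}
                 (\<lambda>s. f (X s w) + G (X s w) *v u s w)))"

text \<open>
  The terminal cost is incurred only on paths that reach \<open>D\<close> in finite time. On \<open>\<Omega>\<close> both costs are
  nonnegative, so the expectation makes sense in \<^typ>\<open>ennreal\<close>.
\<close>

definition expected_cost ::
  "'w measure \<Rightarrow> (real^'n \<Rightarrow> real) \<Rightarrow> (real^'n \<Rightarrow> real) \<Rightarrow> real^'m^'m \<Rightarrow> (real^'n) set \<Rightarrow>
   (real \<Rightarrow> 'w \<Rightarrow> real^'m) \<Rightarrow> (real \<Rightarrow> 'w \<Rightarrow> real^'n) \<Rightarrow> ennreal" where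
  "expected_cost M q \<phi> R D u X =
     (\<integral>\<^sup>+ w. (if hit_time D X w < \<infinity>
              then ennreal (\<phi> (X (real_of_ereal (hit_time D X w)) w)) else 0)
       + (\<integral>\<^sup>+ t\<in>{t. 0 \<le> t \<and> ereal t < hit_time D X w}.
            ennreal (q (X t w) + (u t w \<bullet> (R *v u t w)) / 2) \<partial>lborel) \<partial>M)"

definition value_function ::
  "'w measure \<Rightarrow> (real \<Rightarrow> 'w measure) \<Rightarrow> (real \<Rightarrow> 'w \<Rightarrow> real^'p) \<Rightarrow>
   (real^'n \<Rightarrow> real^'n) \<Rightarrow> (real^'n \<Rightarrow> real^'m^'n) \<Rightarrow> (real^'n \<Rightarrow> real^'p^'n) \<Rightarrow>
   (real^'n \<Rightarrow> real) \<Rightarrow> (real^'n \<Rightarrow> real) \<Rightarrow> real^'m^'m \<Rightarrow>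
   (real^'n) set \<Rightarrow> (real^'n) set \<Rightarrow> real^'n \<Rightarrow> ennreal" where
  "value_function M \<F> W f G B q \<phi> R \<Omega> D x0 =
     Inf {expected_cost M q \<phi> R D u X | u X. controlled_trajectory M \<F> W f G B \<Omega> D x0 u X}"


section \<open>The optimization problem\<close>

definition feasible_P ::
  "(real^'n) set \<Rightarrow> (real^'n) set \<Rightarrow> (real^'n \<Rightarrow> real^'n) \<Rightarrow> (real^'n \<Rightarrow> real^'n^'n) \<Rightarrow>
   (real^'n \<Rightarrow> real) \<Rightarrow> real \<Rightarrow> (real^'n \<Rightarrow> real) \<Rightarrow>
   (real^'n \<Rightarrow> real) \<Rightarrow> (real^'n \<Rightarrow> real) \<Rightarrow> real \<Rightarrow> bool" where
  "feasible_P \<Omega> D f A q lam \<psi> \<Psi>l \<Psi>u \<epsilon> \<longleftrightarrow>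
     real_polynomial_function \<Psi>l \<and> real_polynomial_function \<Psi>u \<and>
     (\<forall>x\<in>\<Omega>. (1 / lam) * q x * \<Psi>l x - lin_op f A \<Psi>l x \<le> 0) \<and>
     (\<forall>x\<in>\<Omega>. 0 \<le> (1 / lam) * q x * \<Psi>u x - lin_op f A \<Psi>u x) \<and>
     (\<forall>x\<in>\<Omega>. \<Psi>u x - \<Psi>l x \<le> \<epsilon>) \<and>
     (\<forall>x\<in>D. 0 \<le> \<Psi>l x \<and> \<Psi>l x \<le> \<psi> x \<and> \<psi> x \<le> \<Psi>u x) \<and>
     (\<forall>i. \<forall>x\<in>\<Omega>. (0 \<le> x $ i \<longrightarrow> grad \<Psi>l x $ i \<le> 0) \<and> (x $ i \<le> 0 \<longrightarrow> 0 \<le> grad \<Psi>l x $ i)) \<and>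
     \<Psi>l 0 = 1"

definition solves_P ::
  "(real^'n) set \<Rightarrow> (real^'n) set \<Rightarrow> (real^'n \<Rightarrow> real^'n) \<Rightarrow> (real^'n \<Rightarrow> real^'n^'n) \<Rightarrow>
   (real^'n \<Rightarrow> real) \<Rightarrow> real \<Rightarrow> (real^'n \<Rightarrow> real) \<Rightarrow>
   (real^'n \<Rightarrow> real) \<Rightarrow> (real^'n \<Rightarrow> real) \<Rightarrow> real \<Rightarrow> bool" where
  "solves_P \<Omega> D f A q lam \<psi> \<Psi>l \<Psi>u \<epsilon> \<longleftrightarrow>
     feasible_P \<Omega> D f A q lam \<psi> \<Psi>l \<Psi>u \<epsilon> \<and>
     (\<forall>\<Psi>l' \<Psi>u' \<epsilon>'. feasible_P \<Omega> D f A q lam \<psi> \<Psi>l' \<Psi>u' \<epsilon>' \<longrightarrow> \<epsilon> \<le> \<epsilon>')"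

end

theory Submission
  imports Defs
begin

text \<open>
  The polynomials \<open>\<Psi>l\<close> and \<open>\<Psi>u\<close> are smooth, hence admissible test functions for the viscosity
  solution \<open>\<Psi>star\<close>. At a negative minimum of \<open>\<Psi>star - \<Psi>l\<close>, which lies off \<open>D\<close>, testing with \<open>\<Psi>l\<close> gives
  \<open>0 \<le> (q / lam) (\<Psi>star - \<Psi>l)\<close>, which is impossible as \<open>q > 0\<close> there; symmetrically for \<open>\<Psi>u\<close>.
  So \<open>\<Psi>l \<le> \<Psi>star \<le> \<Psi>u \<le> \<Psi>l + \<epsilon>\<close>, and since \<open>\<Psi>star = exp (- Vstar / lam) \<ge> \<eta>\<close>, taking logarithms
  gives the bounds. No maximum principle for two nonsmooth functions is needed.
\<close>

text \<open>Structural induction, with the product rule as its main case. That the gradient is again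
  a polynomial is what allows a second differentiation when the Hessian is computed.\<close>

lemma real_polynomial_function_has_gradient:
  fixes F :: "'a::euclidean_space \<Rightarrow> real"
  assumes "real_polynomial_function F"
  shows "\<exists>P. polynomial_function P \<and> (\<forall>x. (F has_derivative (\<lambda>v. P x \<bullet> v)) (at x))"
  using assms
proof (induction F rule: real_polynomial_function.induct)
  case (linear F)
  then interpret bounded_linear F .
  \<comment> \<open>Riesz representation: expanding \<open>v\<close> in the basis shows which fixed
    vector represents the functional \<open>F\<close>.\<close>
  have "F v = (\<Sum>b\<in>Basis. F b *\<^sub>R b) \<bullet> v" for v
    by (subst euclidean_representation[of v, symmetric], simp only: sum scaleR)
      (simp add: inner_sum_left inner_sum_right inner_commute mult.commute)
  then have "(F has_derivative (\<lambda>v. (\<Sum>b\<in>Basis. F b *\<^sub>R b) \<bullet> v)) (at x)" for x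
    by (rule has_derivative_eq_rhs[OF bounded_linear_imp_has_derivative[OF bounded_linear_axioms] ext])
  then show ?case
    by (intro exI[of _ "\<lambda>_. \<Sum>b\<in>Basis. F b *\<^sub>R b"] conjI polynomial_function_const) blast
next
  case (const c)
  show ?case
    by (intro exI[of _ "\<lambda>_. 0"]) simp
next
  case (add F1 F2)
  then obtain P1 P2 where P: "polynomial_function P1" "polynomial_function P2"
    "\<And>x. (F1 has_derivative (\<lambda>v. P1 x \<bullet> v)) (at x)"
    "\<And>x. (F2 has_derivative (\<lambda>v. P2 x \<bullet> v)) (at x)"
    by blast
  then show ?case
    by (intro exI[of _ "\<lambda>x. P1 x + P2 x"])
      (auto simp: inner_add_left intro!: has_derivative_add)
next
  case (mult F1 F2)
  then obtain P1 P2 where P: "polynomial_function P1" "polynomial_function P2"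
    "\<And>x. (F1 has_derivative (\<lambda>v. P1 x \<bullet> v)) (at x)"
    "\<And>x. (F2 has_derivative (\<lambda>v. P2 x \<bullet> v)) (at x)"
    by blast
  have "polynomial_function (\<lambda>x. F1 x *\<^sub>R P2 x + F2 x *\<^sub>R P1 x)"
    using mult.hyps P
    by (intro polynomial_function_add polynomial_function_mult)
      (simp_all add: real_polynomial_function_eq)
  moreover have "((\<lambda>x. F1 x * F2 x) has_derivative (\<lambda>v. (F1 x *\<^sub>R P2 x + F2 x *\<^sub>R P1 x) \<bullet> v)) (at x)" for x
    by (rule has_derivative_eq_rhs[OF has_derivative_mult[OF P(3,4)]])
      (simp add: inner_add_left mult.commute)
  ultimately show ?case
    by blast
qed

lemma grad_eq:
  fixes F :: "real^'n \<Rightarrow> real"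
  assumes "(F has_derivative (\<lambda>v. p \<bullet> v)) (at x)"
  shows "grad F x = p"
  unfolding grad_def frechet_derivative_at[OF assms, symmetric]
  by (simp add: vec_eq_iff inner_axis)

lemma real_polynomial_function_grad:
  fixes F :: "real^'n \<Rightarrow> real"
  assumes "real_polynomial_function F"
  shows "polynomial_function (grad F)" and "(F has_derivative (\<lambda>v. grad F x \<bullet> v)) (at x)"
proof -
  obtain P where P: "polynomial_function P" "\<And>x. (F has_derivative (\<lambda>v. P x \<bullet> v)) (at x)"
    using real_polynomial_function_has_gradient[OF assms] by blast
  moreover have "grad F = P"
    using grad_eq[OF P(2)] by (rule ext)
  ultimately show "polynomial_function (grad F)" "(F has_derivative (\<lambda>v. grad F x \<bullet> v)) (at x)"
    by simp_all
qed

text \<open>Each component of \<open>grad F\<close> is itself a real polynomial, so the gradient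
  lemma applies a second time. The rows of the Hessian are the resulting polynomial gradients, hence
  continuous.\<close>

lemma real_polynomial_function_C2_on:
  fixes F :: "real^'n \<Rightarrow> real"
  assumes "real_polynomial_function F"
  shows "C2_on S F"
proof -
  define P where "P i = grad (\<lambda>y. grad F y $ i)" for i
  have comp: "real_polynomial_function (\<lambda>y. grad F y $ i)" for i
    using real_polynomial_function_grad(1)[OF assms]
    by (simp add: polynomial_function_iff_Basis_inner cart_eq_inner_axis axis_in_Basis_iff)
  have "((\<lambda>y. grad F y $ i) has_derivative (\<lambda>v. P i x \<bullet> v)) (at x)" for x i
    unfolding P_def by (rule real_polynomial_function_grad(2)[OF comp])
  \<comment> \<open>Differentiability of a vector-valued map is checked componentwise; the
    \<open>P i x\<close> become the rows of its Jacobian.\<close>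
  then have D: "(grad F has_derivative (\<lambda>v. \<chi> i. P i x \<bullet> v)) (at x)" for x
    by (subst has_derivative_componentwise_within) (auto simp: Basis_vec_def inner_axis)
  have "hess F = (\<lambda>x. \<chi> i j. P i x $ j)"
    unfolding fun_eq_iff hess_def jacobian_def frechet_derivative_at[OF D, symmetric]
    by (simp add: matrix_def vec_eq_iff inner_axis)
  moreover have "continuous_on S (P i)" for i
    unfolding P_def
    using continuous_on_polymonial_function[OF real_polynomial_function_grad(1)[OF comp]] .
  ultimately have "continuous_on S (hess F)"
    by (auto intro!: continuous_on_vec_lambda continuous_on_component)
  then show ?thesis
    unfolding C2_on_def
    using D real_polynomial_function_grad(2)[OF assms] by (auto simp: differentiable_def)
qed

text \<open>As \<open>w\<close> is smooth, it serves as its own test function at a minimum of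
  \<open>v - w\<close>. The zeroth-order term, with \<open>q\<close> strictly positive off
  \<open>D\<close>, rules out a negative minimum.\<close>

lemma linear_supersolution_ge:
  fixes S D :: "(real^'n) set"
  assumes S: "compact S" and v: "continuous_on S v"
    and super: "viscosity_supersolution_on (S - D) (linear_operator f A q lam) v"
    and w: "continuous_on S w" "C2_on (S - D) w"
    and sub: "\<And>x. x \<in> S - D \<Longrightarrow> (1 / lam) * q x * w x - lin_op f A w x \<le> 0"
    and bd: "\<And>x. x \<in> S \<inter> D \<Longrightarrow> w x \<le> v x"
    and q: "\<And>x. x \<in> S - D \<Longrightarrow> 0 < q x" and lam: "0 < lam" and x: "x \<in> S"
  shows "w x \<le> v x"
proof (rule ccontr)
  assume neg: "\<not> w x \<le> v x"
  have "continuous_on S (\<lambda>y. v y - w y)"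
    using v w by (intro continuous_on_diff)
  then obtain x0 where x0: "x0 \<in> S" and min: "\<And>y. y \<in> S \<Longrightarrow> v x0 - w x0 \<le> v y - w y"
    using continuous_attains_inf[OF S] x by blast
  have neg0: "v x0 < w x0"
    using min[OF x] neg by simp
  \<comment> \<open>On \<open>D\<close> the boundary inequality gives \<open>w \<le> v\<close>, so a
    point with \<open>v x0 < w x0\<close> cannot lie there.\<close>
  then have mem: "x0 \<in> S - D"
    using bd[of x0] x0 by force
  have "\<forall>\<^sub>F y in at x0 within S - D. v x0 - w x0 \<le> v y - w y"
    using min by (auto simp: eventually_at_filter)
  then have "0 \<le> linear_operator f A q lam x0 (v x0) (grad w x0) (hess w x0)"
    using super w(2) mem unfolding viscosity_supersolution_on_def by blast
  \<comment> \<open>Both inequalities contain \<open>generator\<close> at the same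
    \<open>grad w x0\<close> and \<open>hess w x0\<close>. It cancels, leaving only the zeroth-order
    terms.\<close>
  with sub[OF mem] have "(1 / lam) * q x0 * w x0 \<le> (1 / lam) * q x0 * v x0"
    by (simp add: linear_operator_def lin_op_def)
  then show False
    using neg0 lam q[OF mem] by (simp add: divide_le_cancel)
qed

text \<open>The mirror image: a positive maximum of \<open>v - w\<close> is excluded by testing the
  subsolution \<open>v\<close> with \<open>w\<close>.\<close>

lemma linear_subsolution_le:
  fixes S D :: "(real^'n) set"
  assumes S: "compact S" and v: "continuous_on S v"
    and vsub: "viscosity_subsolution_on (S - D) (linear_operator f A q lam) v"
    and w: "continuous_on S w" "C2_on (S - D) w"
    and super: "\<And>x. x \<in> S - D \<Longrightarrow> 0 \<le> (1 / lam) * q x * w x - lin_op f A w x"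
    and bd: "\<And>x. x \<in> S \<inter> D \<Longrightarrow> v x \<le> w x"
    and q: "\<And>x. x \<in> S - D \<Longrightarrow> 0 < q x" and lam: "0 < lam" and x: "x \<in> S"
  shows "v x \<le> w x"
proof (rule ccontr)
  assume pos: "\<not> v x \<le> w x"
  have "continuous_on S (\<lambda>y. v y - w y)"
    using v w by (intro continuous_on_diff)
  then obtain x0 where x0: "x0 \<in> S" and max: "\<And>y. y \<in> S \<Longrightarrow> v y - w y \<le> v x0 - w x0"
    using continuous_attains_sup[OF S] x by blast
  have pos0: "w x0 < v x0"
    using max[OF x] pos by simp
  then have mem: "x0 \<in> S - D"
    using bd[of x0] x0 by force
  have "\<forall>\<^sub>F y in at x0 within S - D. v y - w y \<le> v x0 - w x0"
    using max by (auto simp: eventually_at_filter)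
  then have "linear_operator f A q lam x0 (v x0) (grad w x0) (hess w x0) \<le> 0"
    using vsub w(2) mem unfolding viscosity_subsolution_on_def by blast
  with super[OF mem] have "(1 / lam) * q x0 * v x0 \<le> (1 / lam) * q x0 * w x0"
    by (simp add: linear_operator_def lin_op_def)
  then show False
    using pos0 lam q[OF mem] by (simp add: divide_le_cancel)
qed

text \<open>Compactness bounds the image, so the conditionally complete supremum is a genuine upper
  bound.\<close>

lemma abs_le_sup_norm_on:
  fixes F :: "'a::topological_space \<Rightarrow> real"
  assumes "compact S" "continuous_on S F" "x \<in> S"
  shows "\<bar>F x\<bar> \<le> sup_norm_on S F"
proof -
  have "compact ((\<lambda>x. \<bar>F x\<bar>) ` S)"
    using assms(1,2) by (intro compact_continuous_image continuous_intros)
  then have "bdd_above ((\<lambda>x. \<bar>F x\<bar>) ` S)"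
    by (intro bounded_imp_bdd_above compact_imp_bounded)
  then show ?thesis
    unfolding sup_norm_on_def using assms(3) by (intro cSUP_upper)
qed

text \<open>Dividing the additive gap by \<open>b\<close> gives the ratio bound
  \<open>a / b \<ge> 1 - e / b\<close>. The hypotheses force \<open>0 \<le> e\<close>, so replacing
  \<open>b\<close> by the smaller \<open>c\<close> only weakens it, and \<open>e < c\<close> keeps
  the argument of \<open>ln\<close> positive.\<close>

lemma ln_diff_le_of_additive_gap:
  fixes a b :: real
  assumes "0 < a" "a \<le> b" "b \<le> a + e" "c \<le> b" "0 < c" "e < c"
  shows "ln b - ln a \<le> - ln (1 - e / c)"
proof -
  have "e / b \<le> e / c"
    using assms by (intro divide_left_mono) auto
  moreover have "1 - e / b \<le> a / b"
    using assms divide_right_mono[of "b - e" a b] by (simp add: diff_divide_distrib)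
  ultimately have "1 - e / c \<le> a / b"
    by linarith
  then have "ln (1 - e / c) \<le> ln (a / b)"
    using assms by (subst ln_le_cancel_iff) auto
  also have "\<dots> = ln a - ln b"
    using assms by (simp add: ln_div)
  finally show ?thesis
    by simp
qed

theorem theorem19:
  fixes \<Omega> D :: "(real^'n) set"
    and g h :: "nat \<Rightarrow> real^'n \<Rightarrow> real" and k m :: nat
    and f :: "real^'n \<Rightarrow> real^'n" and G :: "real^'n \<Rightarrow> real^'m^'n" and B :: "real^'n \<Rightarrow> real^'p^'n"
    and R :: "real^'m^'m" and \<Sigma>\<epsilon> :: "real^'p^'p"
    and q \<phi> \<psi> :: "real^'n \<Rightarrow> real" and lam :: real
    and M :: "'w measure" and \<F> :: "real \<Rightarrow> 'w measure" and W :: "real \<Rightarrow> 'w \<Rightarrow> real^'p"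
    and Vstar \<Psi>star \<Psi>l \<Psi>u Vu :: "real^'n \<Rightarrow> real" and \<epsilon> \<eta> :: real
  assumes "\<And>i. i \<in> {1..k} \<Longrightarrow> real_polynomial_function (g i)"
    and "\<Omega> = {x. \<forall>i\<in>{1..k}. 0 \<le> g i x}" and "compact \<Omega>" and "0 \<in> \<Omega>"
    and "\<And>i. i \<in> {1..m} \<Longrightarrow> real_polynomial_function (h i)"
    and "D = insert 0 (frontier \<Omega>)" and "D = insert 0 {x. (\<Prod>i=1..m. h i x) = 0}"
    and "polynomial_function f" and "polynomial_function G" and "polynomial_function B"
    and "f 0 = 0" and "G 0 = 0" and "B 0 = 0"
    and "pos_def_matrix R"
    and "real_polynomial_function q" and "q 0 = 0" and "\<And>x. x \<in> \<Omega> - {0} \<Longrightarrow> 0 < q x"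
    and "real_polynomial_function \<phi>" and "\<phi> 0 = 0" and "\<And>x. x \<in> \<Omega> - {0} \<Longrightarrow> 0 < \<phi> x"
    and "brownian_motion M \<F> \<Sigma>\<epsilon> W"
    and "0 < lam"
    and "\<And>x. x \<in> \<Omega> \<Longrightarrow>
           lam *\<^sub>R (G x ** matrix_inv R ** transpose (G x)) = noise_cov B \<Sigma>\<epsilon> x"
    and "\<psi> = (\<lambda>x. exp (- \<phi> x / lam))"
    and "unique_viscosity_solution \<Omega> D (hjb_operator f G (noise_cov B \<Sigma>\<epsilon>) q R) \<phi> Vstar"
    and "unique_viscosity_solution \<Omega> D (linear_operator f (noise_cov B \<Sigma>\<epsilon>) q lam) \<psi> \<Psi>star"
    and "\<And>x. x \<in> \<Omega> \<Longrightarrow> Vstar x = - lam * ln (\<Psi>star x)"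
    and "\<And>x. x \<in> \<Omega> \<Longrightarrow>
           enn2ereal (value_function M \<F> W f G B q \<phi> R \<Omega> D x) = ereal (Vstar x)"
    and "solves_P \<Omega> D f (noise_cov B \<Sigma>\<epsilon>) q lam \<psi> \<Psi>l \<Psi>u \<epsilon>"
    and "\<And>x. x \<in> \<Omega> \<Longrightarrow> 0 < \<Psi>l x"
    and "Vu = (\<lambda>x. - lam * ln (\<Psi>l x))"
    and "\<eta> = exp (- sup_norm_on \<Omega> Vstar / lam)"
  shows "\<forall>x\<in>\<Omega>. 0 \<le> Vu x - Vstar x \<and>
           ereal (Vu x - Vstar x) \<le>
             (if \<epsilon> < \<eta> then ereal (- lam * ln (1 - min 1 (\<epsilon> / \<eta>))) else \<infinity>)"
proof
  fix x assume x: "x \<in> \<Omega>"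
  note compact = \<open>compact \<Omega>\<close> and lam = \<open>0 < lam\<close>
  \<comment> \<open>The origin, the only zero of \<open>q\<close> in \<open>\<Omega>\<close>,
    belongs to \<open>D\<close>.\<close>
  have q: "\<And>y. y \<in> \<Omega> - D \<Longrightarrow> 0 < q y"
    using assms(6,17) by blast
  have visc: "continuous_on \<Omega> \<Psi>star" "\<And>y. y \<in> D \<Longrightarrow> \<Psi>star y = \<psi> y"
    "viscosity_subsolution_on (\<Omega> - D) (linear_operator f (noise_cov B \<Sigma>\<epsilon>) q lam) \<Psi>star"
    "viscosity_supersolution_on (\<Omega> - D) (linear_operator f (noise_cov B \<Sigma>\<epsilon>) q lam) \<Psi>star"
    and V: "continuous_on \<Omega> Vstar"
    using assms(25,26) by (auto simp: unique_viscosity_solution_def viscosity_solution_def)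
  have feas: "feasible_P \<Omega> D f (noise_cov B \<Sigma>\<epsilon>) q lam \<psi> \<Psi>l \<Psi>u \<epsilon>"
    using assms(29) by (simp add: solves_P_def)
  then have poly: "real_polynomial_function \<Psi>l" "real_polynomial_function \<Psi>u"
    and gap: "\<Psi>u x - \<Psi>l x \<le> \<epsilon>"
    using x by (auto simp: feasible_P_def)
  have cont: "continuous_on \<Omega> \<Psi>l" "continuous_on \<Omega> \<Psi>u"
    using poly by (auto simp: real_polynomial_function_eq intro: continuous_on_polymonial_function)
  \<comment> \<open>The two open premises are the differential inequality and the boundary
    comparison from (P), the latter read through \<open>\<Psi>star = \<psi>\<close> on
    \<open>D\<close>.\<close>
  have lower: "\<Psi>l x \<le> \<Psi>star x"
    by (rule linear_supersolution_ge[OF compact visc(1,4) cont(1)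
          real_polynomial_function_C2_on[OF poly(1)] _ _ q lam x])
      (use feas visc(2) in \<open>auto simp: feasible_P_def\<close>)
  have upper: "\<Psi>star x \<le> \<Psi>u x"
    by (rule linear_subsolution_le[OF compact visc(1,3) cont(2)
          real_polynomial_function_C2_on[OF poly(2)] _ _ q lam x])
      (use feas visc(2) in \<open>auto simp: feasible_P_def\<close>)
  \<comment> \<open>Positivity of \<open>\<Psi>star\<close> is inherited from
    \<open>\<Psi>l\<close>; it makes the logarithmic transform invertible below.\<close>
  have pos: "0 < \<Psi>l x" "0 < \<Psi>star x"
    using assms(30)[OF x] lower by auto
  have diff: "Vu x - Vstar x = lam * (ln (\<Psi>star x) - ln (\<Psi>l x))"
    using assms(27)[OF x] assms(31) by (simp add: algebra_simps)
  have nonneg: "0 \<le> Vu x - Vstar x"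
    unfolding diff using lam lower pos by simp
  have "Vstar x \<le> sup_norm_on \<Omega> Vstar"
    using abs_le_sup_norm_on[OF compact V x] by simp
  \<comment> \<open>\<open>\<eta>\<close> is a lower bound for \<open>\<Psi>star\<close> because
    \<open>exp (- v / lam)\<close> decreases in \<open>v\<close>.\<close>
  then have "\<eta> \<le> exp (- Vstar x / lam)"
    using lam assms(32) by (simp add: divide_right_mono)
  also have "\<dots> = \<Psi>star x"
    using assms(27)[OF x] lam pos by simp
  finally have \<eta>: "\<eta> \<le> \<Psi>star x" "0 < \<eta>"
    using assms(32) by auto
  \<comment> \<open>Only this case needs work, since for \<open>\<epsilon> \<ge> \<eta>\<close> the
    bound is infinite.\<close>
  have "Vu x - Vstar x \<le> - lam * ln (1 - min 1 (\<epsilon> / \<eta>))" if "\<epsilon> < \<eta>"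
  proof -
    have "ln (\<Psi>star x) - ln (\<Psi>l x) \<le> - ln (1 - \<epsilon> / \<eta>)"
      using pos lower upper gap \<eta> that by (intro ln_diff_le_of_additive_gap) auto
    then have "lam * (ln (\<Psi>star x) - ln (\<Psi>l x)) \<le> lam * - ln (1 - \<epsilon> / \<eta>)"
      using lam by (intro mult_left_mono) auto
    moreover have "min 1 (\<epsilon> / \<eta>) = \<epsilon> / \<eta>"
      using that \<eta>(2) by simp
    ultimately show ?thesis
      unfolding diff by simp
  qed
  with nonneg show "0 \<le> Vu x - Vstar x \<and>
      ereal (Vu x - Vstar x) \<le>
        (if \<epsilon> < \<eta> then ereal (- lam * ln (1 - min 1 (\<epsilon> / \<eta>))) else \<infinity>)"
    by simp
qed

end
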